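(* Let $X$ be a finite dimensional polyhedral Banach space. Then the unit ball of $X$ is an isometrically representing subset of $X$.
   Context: Banach spaces are real. A finite dimensional Banach space $X$ is polyhedral if its closed unit ball $B_X$ is a polytope, i.e. there are finitely many norm-one functionals $x_1^*,\dots,x_k^*\in X^*$ with $B_X=\bigcap_{i=1}^k\{x\in X : |x_i^*(x)|\le 1\}$. A subset $K$ of a separable Banach space $X$ (with the metric induced by the norm) is called an isometrically representing subset of $X$ if, whenever $K$ embeds isometrically (via a distance-preserving, not necessarily linear or affine, map) into a Banach space $Y$, the space $X$ embeds linearly isometrically into $Y$. *)

theory Defs
  imports "HOL-Analysis.Analysis"
begin

text \<open>A Banach space is a type of class \<open>banach\<close>; properties of a space are predicates on its
  type, passed as \<open>TYPE('a)\<close>.\<close>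

definition finite_dimensional :: "'a::real_vector itself \<Rightarrow> bool" where
  "finite_dimensional _ \<longleftrightarrow> (\<exists>B :: 'a set. finite B \<and> span B = UNIV)"

text \<open>The empty family is allowed, as needed for the zero space, which has no functionals of
  norm one.\<close>

definition polyhedral_space :: "'a::banach itself \<Rightarrow> bool" where
  "polyhedral_space _ \<longleftrightarrow> finite_dimensional TYPE('a) \<and>
     (\<exists>F :: ('a \<Rightarrow>\<^sub>L real) set. finite F \<and> (\<forall>\<phi>\<in>F. norm \<phi> = 1) \<and>
        cball 0 1 = (\<Inter>\<phi>\<in>F. {x. \<bar>blinfun_apply \<phi> x\<bar> \<le> 1}))"

definition embeds_isometrically ::
  "'a::metric_space set \<Rightarrow> 'b::metric_space itself \<Rightarrow> bool" where
  "embeds_isometrically K _ \<longleftrightarrow>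
     (\<exists>f :: 'a \<Rightarrow> 'b. \<forall>x\<in>K. \<forall>y\<in>K. dist (f x) (f y) = dist x y)"

definition embeds_linearly_isometrically ::
  "'a::real_normed_vector itself \<Rightarrow> 'b::real_normed_vector itself \<Rightarrow> bool" where
  "embeds_linearly_isometrically _ _ \<longleftrightarrow>
     (\<exists>T :: 'a \<Rightarrow> 'b. linear T \<and> (\<forall>x. norm (T x) = norm x))"

text \<open>HOL cannot quantify over types inside a formula, so the target space is a parameter. A
  theorem concluding \<open>isometrically_representing K TYPE('b)\<close> for a type variable
  \<open>'b::banach\<close> that occurs nowhere else asserts the property for every Banach space \<open>'b\<close>, that is,
  that \<open>K\<close> is isometrically representing. As a hypothesis it would only concern
  the one space \<open>'b\<close>.\<close>

definition isometrically_representing :: "'a::banach set \<Rightarrow> 'b::banach itself \<Rightarrow> bool" where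
  "isometrically_representing K _ \<longleftrightarrow> separable_space (euclidean :: 'a topology) \<and>
     (embeds_isometrically K TYPE('b) \<longrightarrow> embeds_linearly_isometrically TYPE('a) TYPE('b))"

end

theory Submission
  imports Defs
begin

text \<open>
  Let \<open>f\<close> be an isometry of the unit ball of a polyhedral space into a Banach space, and let
  \<open>\<phi>\<^sub>1, \<dots>, \<phi>\<^sub>k\<close> be an irredundant family of functionals of norm one that defines the ball. There are
  two ideas.

  First, each \<open>\<phi>\<^sub>i\<close> can be read off from \<open>f\<close> near the origin. Irredundancy gives a point \<open>p\<close> in the
  relative interior of the facet \<open>\<phi>\<^sub>i = 1\<close>. For small \<open>u\<close> the distances from \<open>u\<close> to \<open>p\<close> and \<open>-p\<close> are
  then at most \<open>1 - \<phi>\<^sub>i u\<close> and \<open>1 + \<phi>\<^sub>i u\<close> (\<open>facet_distance\<close>), which add up to the distance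
  between \<open>p\<close> and \<open>-p\<close>: every small \<open>u\<close> lies metrically between the two points. A functional \<open>\<eta>\<^sub>i\<close>
  of norm one that attains its norm at \<open>f p - f (- p)\<close> turns this into the identity
  \<open>\<eta>\<^sub>i (f u) = \<phi>\<^sub>i u + const\<close> (\<open>facet_functional_factors\<close>).

  Second, the map \<open>f\<close> can be replaced by a linear map without losing these identities
  (\<open>Lipschitz_linearization\<close>). Averaging translates of \<open>f\<close> against a smooth bump function gives a
  differentiable map. Near the origin it is still \<open>1\<close>-Lipschitz, and its composition with \<open>\<eta>\<^sub>i\<close> is
  still \<open>\<phi>\<^sub>i\<close> up to a constant. The derivative \<open>T\<close> of this map at the origin is a linear contraction with
  \<open>\<eta>\<^sub>i \<circ> T = \<phi>\<^sub>i\<close>, so \<open>\<bar>\<phi>\<^sub>i x\<bar> \<le> norm (T x)\<close> for all \<open>i\<close>. As the \<open>\<phi>\<^sub>i\<close> determine the norm,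
  \<open>T\<close> is an isometry. Averaging keeps the values in the target because it is complete.
\<close>

section \<open>Norming functionals\<close>

definition sublinear :: "('v::real_vector \<Rightarrow> real) \<Rightarrow> bool" where
  "sublinear p \<longleftrightarrow> (\<forall>x y. p (x + y) \<le> p x + p y) \<and> (\<forall>t>0. \<forall>x. p (t *\<^sub>R x) \<le> t * p x)"

lemma sublinear_add: "sublinear p \<Longrightarrow> p (x + y) \<le> p x + p y"
  by (simp add: sublinear_def)

lemma sublinear_scaleR:
  assumes "sublinear p" "t > 0"
  shows "p (t *\<^sub>R x) = t * p x"
proof (rule antisym)
  show "p (t *\<^sub>R x) \<le> t * p x"
    using assms by (simp add: sublinear_def)
  have "p (inverse t *\<^sub>R t *\<^sub>R x) \<le> inverse t * p (t *\<^sub>R x)"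
    using assms unfolding sublinear_def by (metis positive_imp_inverse_positive)
  then show "t * p x \<le> p (t *\<^sub>R x)"
    using \<open>t > 0\<close> by (simp add: field_simps)
qed

lemma sublinear_0: "sublinear p \<Longrightarrow> p 0 = 0"
  using sublinear_scaleR[of p 2 0] by simp

lemma sublinear_minus: "sublinear p \<Longrightarrow> - p (- x) \<le> p x"
  using sublinear_add[of p x "- x"] by (simp add: sublinear_0)

lemma sublinear_norm: "sublinear (norm :: 'v::real_normed_vector \<Rightarrow> real)"
  by (simp add: sublinear_def norm_triangle_ineq)

text \<open>
  The limit of \<open>p (x + t z) - t p z\<close> as \<open>t\<close> grows is sublinear, lies below \<open>p\<close> and is odd in the
  direction \<open>z\<close>. The difference decreases in \<open>t\<close>, so the limit is an infimum, which is the form used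
  here. The construction serves twice: it shows that a minimal sublinear functional is odd,
  hence linear, and it forces a dominated linear functional to take the value \<open>p z\<close> at \<open>z\<close>.
\<close>

lemma sublinear_make_odd_along:
  assumes p: "sublinear p"
  obtains q where "sublinear q" "\<And>x. q x \<le> p x" "q (- z) \<le> - p z"
proof -
  define q where "q x = (INF t\<in>{0..}. p (x + t *\<^sub>R z) - t * p z)" for x
  have hom: "p (t *\<^sub>R z) = t * p z" if "t \<ge> 0" for t
    using sublinear_scaleR[OF p, of t z] sublinear_0[OF p] that by (cases "t = 0") auto
  have "- p (- x) \<le> p (x + t *\<^sub>R z) - t * p z" if "t \<ge> 0" for x t
    using sublinear_add[OF p, of "x + t *\<^sub>R z" "- x"] hom[OF that] by simp
  then have bdd: "bdd_below ((\<lambda>t. p (x + t *\<^sub>R z) - t * p z) ` {0..})" for x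
    by (intro bdd_belowI2[where m = "- p (- x)"]) auto
  have q_le: "q x \<le> p (x + t *\<^sub>R z) - t * p z" if "t \<ge> 0" for x t
    unfolding q_def by (rule cINF_lower[OF bdd]) (use that in auto)
  have q_ge: "c \<le> q x" if "\<And>t. t \<ge> 0 \<Longrightarrow> c \<le> p (x + t *\<^sub>R z) - t * p z" for c x
    unfolding q_def by (rule cINF_greatest) (use that in auto)
  show thesis
  proof
    show "sublinear q"
      unfolding sublinear_def
    proof (intro conjI allI impI)
      fix x y
      have "q (x + y) \<le> (p (x + s *\<^sub>R z) - s * p z) + (p (y + t *\<^sub>R z) - t * p z)"
        if "s \<ge> 0" "t \<ge> 0" for s t
        using q_le[of "s + t" "x + y"] sublinear_add[OF p, of "x + s *\<^sub>R z" "y + t *\<^sub>R z"] that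
        by (simp add: algebra_simps)
      then have "q (x + y) - (p (x + s *\<^sub>R z) - s * p z) \<le> q y" if "s \<ge> 0" for s
        using that by (intro q_ge) (simp add: diff_le_eq add.commute)
      then have "q (x + y) - q y \<le> q x"
        by (intro q_ge) (simp add: algebra_simps)
      then show "q (x + y) \<le> q x + q y" by simp
    next
      fix t :: real and x assume "t > 0"
      have "q (t *\<^sub>R x) / t \<le> p (x + s *\<^sub>R z) - s * p z" if "s \<ge> 0" for s
        using q_le[of "t * s" "t *\<^sub>R x"] sublinear_scaleR[OF p \<open>t > 0\<close>, of "x + s *\<^sub>R z"] that \<open>t > 0\<close>
        by (simp add: field_simps)
      then have "q (t *\<^sub>R x) / t \<le> q x" by (rule q_ge)
      then show "q (t *\<^sub>R x) \<le> t * q x" using \<open>t > 0\<close> by (simp add: field_simps)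
    qed
    show "q x \<le> p x" for x using q_le[of 0 x] by simp
    show "q (- z) \<le> - p z" using q_le[of 1 "- z"] sublinear_0[OF p] by simp
  qed
qed

text \<open>
  The infimum exists because \<open>- p0 (- x)\<close> is a common lower bound at \<open>x\<close>. Of two members of the
  chain, the smaller one at both points gives subadditivity.
\<close>

lemma sublinear_chain_INF:
  fixes C :: "('v::real_vector \<Rightarrow> real) set"
  assumes "C \<noteq> {}" and sub: "\<And>p. p \<in> C \<Longrightarrow> sublinear p"
    and dom: "\<And>p. p \<in> C \<Longrightarrow> p \<le> p0" and chain: "\<And>p q. p \<in> C \<Longrightarrow> q \<in> C \<Longrightarrow> p \<le> q \<or> q \<le> p"
  shows "sublinear (\<lambda>x. INF p\<in>C. p x)" "\<And>p x. p \<in> C \<Longrightarrow> (INF p\<in>C. p x) \<le> p x"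
proof -
  have "- p0 (- x) \<le> p x" if "p \<in> C" for p x
    using sublinear_minus[OF sub[OF that], of x] dom[OF that] by (meson le_funD neg_le_iff_le order_trans)
  then have bdd: "bdd_below ((\<lambda>p. p x) ` C)" for x
    by (intro bdd_belowI2[where m = "- p0 (- x)"])
  show le: "(INF p\<in>C. p x) \<le> p x" if "p \<in> C" for p x
    by (rule cINF_lower[OF bdd that])
  show "sublinear (\<lambda>x. INF p\<in>C. p x)"
    unfolding sublinear_def
  proof (intro conjI allI impI)
    fix x y
    have "(INF p\<in>C. p (x + y)) - p x \<le> q y" if "p \<in> C" "q \<in> C" for p q
      using chain[OF that] le[OF that(1), of "x + y"] le[OF that(2), of "x + y"]
        sublinear_add[OF sub[OF that(1)], of x y] sublinear_add[OF sub[OF that(2)], of x y]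
      by (smt (verit, best) le_funD)
    then have "(INF p\<in>C. p (x + y)) - p x \<le> (INF q\<in>C. q y)" if "p \<in> C" for p
      using that by (intro cINF_greatest[OF \<open>C \<noteq> {}\<close>])
    then have "(INF p\<in>C. p (x + y)) - (INF q\<in>C. q y) \<le> (INF p\<in>C. p x)"
      by (intro cINF_greatest[OF \<open>C \<noteq> {}\<close>]) (simp add: algebra_simps)
    then show "(INF p\<in>C. p (x + y)) \<le> (INF p\<in>C. p x) + (INF p\<in>C. p y)" by simp
  next
    fix t :: real and x assume "t > 0"
    have "(INF p\<in>C. p (t *\<^sub>R x)) / t \<le> (INF p\<in>C. p x)"
      using le[of _ "t *\<^sub>R x"] sublinear_scaleR[OF sub \<open>t > 0\<close>] \<open>t > 0\<close>
      by (intro cINF_greatest[OF \<open>C \<noteq> {}\<close>]) (simp add: field_simps)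
    then show "(INF p\<in>C. p (t *\<^sub>R x)) \<le> t * (INF p\<in>C. p x)"
      using \<open>t > 0\<close> by (simp add: field_simps)
  qed
qed

text \<open>
  The analytic Hahn-Banach theorem. By Zorn's lemma there is a minimal sublinear functional below
  the given one, and by \<open>sublinear_make_odd_along\<close> a minimal one is odd in every direction.
\<close>

lemma sublinear_dominates_linear:
  fixes p0 :: "'v::real_vector \<Rightarrow> real"
  assumes "sublinear p0"
  obtains l :: "'v \<Rightarrow> real" where "linear l" "\<And>x. l x \<le> p0 x"
proof -
  define A where "A = {p. sublinear p \<and> p \<le> p0}"
  have "\<exists>m\<in>A. \<forall>a\<in>A. m \<ge> a \<longrightarrow> a = m"
  proof (rule predicate_Zorn)
    show "partial_order_on A (relation_of (\<ge>) A)"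
      by (rule partial_order_on_relation_ofI) auto
    fix C assume C: "C \<in> Chains (relation_of (\<ge>) A)"
    then have chain: "p \<le> q \<or> q \<le> p" if "p \<in> C" "q \<in> C" for p q
      using that by (auto simp: Chains_def relation_of_def)
    have CA: "p \<in> C \<Longrightarrow> p \<in> A" for p
      using C by (auto simp: Chains_def relation_of_def)
    show "\<exists>u\<in>A. \<forall>a\<in>C. a \<ge> u"
    proof (cases "C = {}")
      case True
      then show ?thesis using assms by (auto simp: A_def)
    next
      case False
      note inf = sublinear_chain_INF[OF False, of p0]
      have 1: "sublinear (\<lambda>x. INF p\<in>C. p x)" and 2: "\<And>p x. p \<in> C \<Longrightarrow> (INF p\<in>C. p x) \<le> p x"
        using inf CA chain by (auto simp: A_def)
      have 3: "(\<lambda>x. INF p\<in>C. p x) \<le> p" if "p \<in> C" for p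
        using 2[OF that] by (simp add: le_fun_def)
      moreover obtain p where "p \<in> C" using False by blast
      ultimately have "(\<lambda>x. INF p\<in>C. p x) \<in> A"
        using 1 3[OF \<open>p \<in> C\<close>] CA[OF \<open>p \<in> C\<close>] by (auto simp: A_def intro: order_trans)
      with 3 show ?thesis by blast
    qed
  qed
  then obtain l where l: "sublinear l" "l \<le> p0" and min: "\<And>q. sublinear q \<Longrightarrow> q \<le> p0 \<Longrightarrow> q \<le> l \<Longrightarrow> q = l"
    by (auto simp: A_def)
  have odd: "l (- z) = - l z" for z
  proof -
    obtain q where q: "sublinear q" "\<And>x. q x \<le> l x" "q (- z) \<le> - l z"
      using sublinear_make_odd_along[OF l(1), of z] by blast
    have "q \<le> l" using q(2) by (simp add: le_fun_def)
    then have "q = l" using min[OF q(1)] l(2) by (meson order_trans)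
    then show ?thesis using q(3) sublinear_minus[OF l(1), of z] by simp
  qed
  have add: "l (x + y) = l x + l y" for x y
    using sublinear_add[OF l(1), of x y] sublinear_add[OF l(1), of "- x" "- y"] odd[of "x + y"]
    by (simp add: odd)
  have scale: "l (t *\<^sub>R x) = t * l x" for t x
  proof (cases t "0::real" rule: linorder_cases)
    case less
    then show ?thesis using sublinear_scaleR[OF l(1), of "- t" x] odd[of "t *\<^sub>R x"] by simp
  next
    case greater
    then show ?thesis by (rule sublinear_scaleR[OF l(1)])
  qed (simp add: sublinear_0[OF l(1)])
  show thesis
  proof
    show "linear l" by (rule linearI) (simp_all add: add scale)
    show "l x \<le> p0 x" for x using l(2) by (simp add: le_fun_def)
  qed
qed

text \<open>
  A linear functional below the norm itself need not attain it at \<open>z\<close>; the functional is therefore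
  taken below a sublinear functional that is already odd along \<open>z\<close>.
\<close>

lemma norming_functional:
  fixes z :: "'v::real_normed_vector"
  obtains l :: "'v \<Rightarrow> real" where "bounded_linear l" "\<And>x. \<bar>l x\<bar> \<le> norm x" "l z = norm z"
proof -
  obtain q where q: "sublinear q" "\<And>x. q x \<le> norm x" "q (- z) \<le> - norm z"
    using sublinear_make_odd_along[OF sublinear_norm, of z] by blast
  obtain l :: "'v \<Rightarrow> real" where l: "linear l" "\<And>x. l x \<le> q x"
    using sublinear_dominates_linear[OF q(1)] by blast
  have le: "l x \<le> norm x" for x using l(2)[of x] q(2)[of x] by simp
  have abs: "\<bar>l x\<bar> \<le> norm x" for x
    using le[of x] le[of "- x"] by (simp add: linear_neg[OF l(1)] abs_le_iff)
  show thesis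
  proof
    show "bounded_linear l"
      using abs l(1) by (intro bounded_linear_intro[where K = 1]) (simp_all add: linear_add linear_cmul)
    show "\<bar>l x\<bar> \<le> norm x" for x by (rule abs)
    show "l z = norm z"
      using l(2)[of "- z"] q(3) le[of z] by (simp add: linear_neg[OF l(1)])
  qed
qed

section \<open>Facets of a polyhedral ball\<close>

text \<open>
  In a minimal defining family, dropping \<open>\<phi>\<close> enlarges the ball. A new point violates only the
  constraint of \<open>\<phi>\<close>, and dividing it by its value under \<open>\<phi>\<close> moves it into the relative interior
  of a facet.
\<close>

lemma minimal_polyhedral_family:
  fixes F0 :: "('v::real_normed_vector \<Rightarrow>\<^sub>L real) set"
  assumes "finite F0" "\<And>\<phi>. \<phi> \<in> F0 \<Longrightarrow> norm \<phi> = 1"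
    and ball: "cball 0 1 = (\<Inter>\<phi>\<in>F0. {x. \<bar>blinfun_apply \<phi> x\<bar> \<le> 1})"
  obtains F :: "('v \<Rightarrow>\<^sub>L real) set" where "finite F" "\<And>\<phi>. \<phi> \<in> F \<Longrightarrow> norm \<phi> = 1"
    "cball 0 1 = (\<Inter>\<phi>\<in>F. {x. \<bar>blinfun_apply \<phi> x\<bar> \<le> 1})"
    "\<And>\<phi>. \<phi> \<in> F \<Longrightarrow> \<exists>p. \<phi> p = 1 \<and> (\<forall>\<psi>\<in>F - {\<phi>}. \<bar>\<psi> p\<bar> < 1)"
proof -
  define A where "A = {F. F \<subseteq> F0 \<and> cball 0 1 = (\<Inter>\<phi>\<in>F. {x. \<bar>blinfun_apply \<phi> x\<bar> \<le> 1})}"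
  have "finite A" "A \<noteq> {}"
    using assms by (auto simp: A_def)
  then obtain F where "F \<in> A" and minF: "\<And>H. H \<in> A \<Longrightarrow> H \<subseteq> F \<Longrightarrow> F = H"
    using finite_has_minimal[of A] by blast
  then have F: "F \<subseteq> F0" "cball 0 1 = (\<Inter>\<phi>\<in>F. {x. \<bar>blinfun_apply \<phi> x\<bar> \<le> 1})"
    by (auto simp: A_def)
  show thesis
  proof (rule that[OF _ _ F(2)])
    show "finite F" "\<And>\<phi>. \<phi> \<in> F \<Longrightarrow> norm \<phi> = 1"
      using F(1) assms finite_subset by blast+
    fix \<phi> assume "\<phi> \<in> F"
    then have "F - {\<phi>} \<notin> A" using minF by blast
    then have "cball 0 1 \<noteq> (\<Inter>\<phi>\<in>F - {\<phi>}. {x. \<bar>blinfun_apply \<phi> x\<bar> \<le> 1})" using F(1) by (auto simp: A_def)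
    moreover have "cball 0 1 \<subseteq> (\<Inter>\<phi>\<in>F - {\<phi>}. {x. \<bar>blinfun_apply \<phi> x\<bar> \<le> 1})" using F(2) by auto
    ultimately obtain x where x: "x \<notin> cball 0 1" "\<And>\<psi>. \<psi> \<in> F - {\<phi>} \<Longrightarrow> \<bar>\<psi> x\<bar> \<le> 1"
      by blast
    then have "\<bar>\<phi> x\<bar> > 1" using F(2) by force
    moreover have "\<bar>\<psi> (x /\<^sub>R \<phi> x)\<bar> < 1" if "\<psi> \<in> F - {\<phi>}" for \<psi>
      using x(2)[OF that] \<open>\<bar>\<phi> x\<bar> > 1\<close> by (simp add: blinfun.scaleR_right abs_mult field_simps)
    ultimately show "\<exists>p. \<phi> p = 1 \<and> (\<forall>\<psi>\<in>F - {\<phi>}. \<bar>\<psi> p\<bar> < 1)"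
      by (intro exI[of _ "x /\<^sub>R \<phi> x"]) (auto simp: blinfun.scaleR_right)
  qed
qed

lemma norm_le_polyhedral:
  fixes F :: "('v::real_normed_vector \<Rightarrow>\<^sub>L real) set"
  assumes ball: "cball 0 1 = (\<Inter>\<phi>\<in>F. {x. \<bar>blinfun_apply \<phi> x\<bar> \<le> 1})"
    and "M \<ge> 0" and le: "\<And>\<phi>. \<phi> \<in> F \<Longrightarrow> \<bar>\<phi> x\<bar> \<le> M"
  shows "norm x \<le> M"
proof (rule field_le_epsilon)
  (* The slack e keeps the divisor positive when M = 0. *)
  fix e :: real assume "e > 0"
  have "\<bar>\<phi> (x /\<^sub>R (M + e))\<bar> \<le> 1" if "\<phi> \<in> F" for \<phi>
    using le[OF that] \<open>M \<ge> 0\<close> \<open>e > 0\<close> by (simp add: blinfun.scaleR_right abs_mult field_simps)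
  then have "x /\<^sub>R (M + e) \<in> cball 0 1" unfolding ball by blast
  then show "norm x \<le> M + e" using \<open>M \<ge> 0\<close> \<open>e > 0\<close> by (simp add: field_simps)
qed

text \<open>
  Close to \<open>p\<close> and \<open>-p\<close>, every member of the family other than \<open>\<phi>\<close> stays bounded away from \<open>1\<close> in
  absolute value, so only \<open>\<phi>\<close> constrains the norm there.
\<close>

lemma facet_distance:
  fixes F :: "('v::real_normed_vector \<Rightarrow>\<^sub>L real) set" and \<phi> :: "'v \<Rightarrow>\<^sub>L real"
  assumes "finite F" and ball: "cball 0 1 = (\<Inter>\<phi>\<in>F. {x. \<bar>blinfun_apply \<phi> x\<bar> \<le> 1})"
    and p: "\<phi> p = 1" "\<And>\<psi>. \<psi> \<in> F - {\<phi>} \<Longrightarrow> \<bar>\<psi> p\<bar> < 1"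
  shows "\<forall>\<^sub>F u in nhds 0. norm (p - u) \<le> 1 - \<phi> u \<and> norm (p + u) \<le> 1 + \<phi> u"
proof -
  have lim: "((\<lambda>u. blinfun_apply \<psi> u) \<longlongrightarrow> 0) (nhds 0)" for \<psi> :: "'v \<Rightarrow>\<^sub>L real"
    using continuous_on_tendsto_compose[of UNIV "blinfun_apply \<psi>" "\<lambda>u. u" 0 "nhds 0"]
    by (simp add: linear_continuous_on blinfun.bounded_linear_right blinfun.zero_right filterlim_ident)
  have "\<forall>\<^sub>F u in nhds 0. \<bar>\<psi> u\<bar> + \<bar>\<phi> u\<bar> < 1 - \<bar>\<psi> p\<bar>" if "\<psi> \<in> F - {\<phi>}" for \<psi>
    by (rule order_tendstoD(2)[where y = 0])
      (use p(2)[OF that] in \<open>auto intro!: tendsto_add_zero tendsto_rabs_zero lim\<close>)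
  then have 1: "\<forall>\<^sub>F u in nhds 0. \<forall>\<psi>\<in>F - {\<phi>}. \<bar>\<psi> u\<bar> + \<bar>\<phi> u\<bar> < 1 - \<bar>\<psi> p\<bar>"
    using \<open>finite F\<close> by (intro eventually_ball_finite) auto
  have 2: "\<forall>\<^sub>F u in nhds 0. \<bar>\<phi> u\<bar> < 1"
    by (rule order_tendstoD(2)[where y = 0]) (auto intro!: tendsto_rabs_zero lim)
  show ?thesis
    using 1 2
  proof eventually_elim
    case (elim u)
    have "\<bar>\<psi> (p - u)\<bar> \<le> 1 - \<phi> u \<and> \<bar>\<psi> (p + u)\<bar> \<le> 1 + \<phi> u" if "\<psi> \<in> F" for \<psi>
    proof (cases "\<psi> = \<phi>")
      case True
      then show ?thesis using elim(2) p(1) by (simp add: blinfun.bilinear_simps)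
    next
      case False
      then have "\<bar>\<psi> u\<bar> + \<bar>\<phi> u\<bar> < 1 - \<bar>\<psi> p\<bar>" using elim(1) that by auto
      then have "\<bar>\<psi> p - \<psi> u\<bar> \<le> 1 - \<phi> u \<and> \<bar>\<psi> p + \<psi> u\<bar> \<le> 1 + \<phi> u" by linarith
      then show ?thesis by (simp add: blinfun.bilinear_simps)
    qed
    then show ?case
      using elim(2) by (intro conjI norm_le_polyhedral[OF ball]) auto
  qed
qed

section \<open>Linearizing a Lipschitz map\<close>

lemma has_derivative_max0_square:
  "((\<lambda>s::real. (max 0 s)\<^sup>2) has_derivative (\<lambda>t. 2 * max 0 s * t)) (at s)"
proof -
  have "((\<lambda>s::real. (max 0 s)\<^sup>2) has_real_derivative (2 * max 0 s)) (at s)"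
  proof (cases s "0::real" rule: linorder_cases)
    case less
    have "((\<lambda>s::real. 0) has_real_derivative 2 * max 0 s) (at s)" using less by simp
    then show ?thesis
      by (rule has_field_derivative_transform_within_open[where S = "{..<0}"]) (use less in auto)
  next
    case greater
    have "((\<lambda>s::real. s\<^sup>2) has_real_derivative 2 * s) (at s)"
      by (auto intro!: derivative_eq_intros)
    then show ?thesis
      using greater by (auto intro: has_field_derivative_transform_within_open[where S = "{0<..}"])
  next
    case equal
    have "((\<lambda>h::real. (max 0 h)\<^sup>2 / h) \<longlongrightarrow> 0) (at 0)"
    proof (rule Lim_null_comparison)
      show "\<forall>\<^sub>F h in at 0. norm ((max 0 h)\<^sup>2 / h) \<le> \<bar>h\<bar>"
        by (rule always_eventually) (auto simp: max_def power2_eq_square)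
      show "((\<lambda>h::real. \<bar>h\<bar>) \<longlongrightarrow> 0) (at 0)"
        by (intro tendsto_rabs_zero tendsto_ident_at)
    qed
    then show ?thesis using equal by (simp add: has_field_derivative_iff)
  qed
  then show ?thesis by (simp add: has_field_derivative_def)
qed

text \<open>The square makes this compactly supported function continuously differentiable.\<close>

definition bump :: "real \<Rightarrow> 'n::euclidean_space \<Rightarrow> real" where
  "bump k w = (max 0 (k\<^sup>2 - w \<bullet> w))\<^sup>2"

definition bump_deriv :: "real \<Rightarrow> 'n::euclidean_space \<Rightarrow> 'n \<Rightarrow>\<^sub>L real" where
  "bump_deriv k w = (- 4 * max 0 (k\<^sup>2 - w \<bullet> w)) *\<^sub>R blinfun_inner_right w"

lemma bump_has_derivative: "(bump k has_derivative bump_deriv k w) (at w)"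
proof -
  have 1: "((\<lambda>w. k\<^sup>2 - w \<bullet> w) has_derivative (\<lambda>v. - (2 * (w \<bullet> v)))) (at w)"
    by (auto intro!: derivative_eq_intros simp: inner_commute)
  show ?thesis
    unfolding bump_def
    by (rule has_derivative_eq_rhs[OF has_derivative_compose[OF 1 has_derivative_max0_square]])
      (simp add: bump_deriv_def fun_eq_iff blinfun.bilinear_simps)
qed

lemma continuous_on_bump: "continuous_on S (bump k)"
  by (intro continuous_at_imp_continuous_on ballI has_derivative_continuous[OF bump_has_derivative])

lemma continuous_on_bump_deriv: "continuous_on S (bump_deriv k)"
  unfolding bump_deriv_def by (intro continuous_intros)

lemma bump_nonneg: "0 \<le> bump k w" by (simp add: bump_def)

lemma bump_eq_0: "k > 0 \<Longrightarrow> w \<notin> ball 0 k \<Longrightarrow> bump k w = 0"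
  by (simp add: bump_def power2_norm_eq_inner[symmetric] not_less)

text \<open>
  One direction \<open>v\<close> at a time, so that the bound can involve a seminorm of \<open>v\<close>.
\<close>

lemma has_derivative_at_0_norm_bound:
  fixes g :: "'v::real_normed_vector \<Rightarrow> 'w::real_normed_vector"
  assumes g: "(g has_derivative D) (at 0)" and "\<delta> > 0"
    and bound: "\<And>t. 0 < t \<Longrightarrow> t < \<delta> \<Longrightarrow> norm (g (t *\<^sub>R v) - g 0) \<le> t * M"
  shows "norm (D v) \<le> M"
proof -
  interpret D: bounded_linear D by (rule has_derivative_bounded_linear[OF g])
  have eps: "norm (D v) \<le> M + e * norm v" if "e > 0" for e
  proof -
    obtain d where "d > 0" and d: "\<And>y. norm y < d \<Longrightarrow> norm (g y - g 0 - D y) \<le> e * norm y"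
      using g \<open>e > 0\<close> unfolding has_derivative_at_alt by (metis diff_zero)
    define t where "t = min (\<delta> / 2) (d / (2 * (norm v + 1)))"
    have "t > 0" "t < \<delta>"
      using \<open>\<delta> > 0\<close> \<open>d > 0\<close> by (auto simp: t_def min_less_iff_disj add_nonneg_pos)
    have "t * norm v \<le> d / (2 * (norm v + 1)) * norm v"
      by (intro mult_right_mono) (auto simp: t_def)
    also have "\<dots> < d"
      using \<open>d > 0\<close> by (simp add: field_simps add_nonneg_pos add_pos_nonneg)
    finally have "norm (g (t *\<^sub>R v) - g 0 - D (t *\<^sub>R v)) \<le> e * norm (t *\<^sub>R v)"
      using \<open>t > 0\<close> by (intro d) simp
    then have "norm (D (t *\<^sub>R v)) \<le> t * M + e * norm (t *\<^sub>R v)"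
      using bound[OF \<open>t > 0\<close> \<open>t < \<delta>\<close>] norm_triangle_ineq2[of "D (t *\<^sub>R v)" "g (t *\<^sub>R v) - g 0"]
      by (simp add: norm_minus_commute)
    then have "t * norm (D v) \<le> t * (M + e * norm v)"
      using \<open>t > 0\<close> by (simp add: D.scaleR algebra_simps)
    then show ?thesis using \<open>t > 0\<close> by simp
  qed
  show ?thesis
  proof (rule field_le_epsilon)
    fix e :: real assume "e > 0"
    then show "norm (D v) \<le> M + e"
      using eps[of "e / (norm v + 1)"]
      by (smt (verit, best) divide_pos_pos mult_imp_div_pos_le norm_ge_zero times_divide_eq_left mult_left_mono)
  qed
qed

lemma integral_pos_continuous:
  fixes f :: "'n::euclidean_space \<Rightarrow> real"
  assumes "continuous_on (cbox a b) f" "\<And>x. x \<in> cbox a b \<Longrightarrow> 0 \<le> f x"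
    and "x \<in> box a b" "f x > 0"
  shows "integral (cbox a b) f > 0"
proof -
  have int: "f integrable_on cbox a b" by (rule integrable_continuous[OF assms(1)])
  have "integral (cbox a b) f \<noteq> 0"
  proof
    assume "integral (cbox a b) f = 0"
    then have "(f has_integral 0) (cbox a b)" using int by (metis integrable_integral)
    moreover have "box a b \<noteq> {}" "x \<in> cbox a b"
      using assms(3) box_subset_cbox by blast+
    moreover have "0 \<le> f y" if "y \<in> box a b" for y
      using assms(2) that box_subset_cbox by blast
    ultimately have "f x = 0" using has_integral_0_cbox_imp_0[OF assms(1)] by blast
    then show False using assms by simp
  qed
  then show ?thesis using integral_nonneg[OF int assms(2)] by simp
qed

text \<open>
  The map \<open>T\<close> is the normalized derivative at the origin of the convolution of \<open>h\<close> with a bump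
  function. The convolution is used in two forms. With the shift in the bump function it can be
  differentiated under the integral sign, although \<open>h\<close> is only Lipschitz. With the shift in \<open>h\<close> it is
  an average of translates of \<open>h\<close>, and both the Lipschitz bound and the identities \<open>\<eta> (h u) = A u + d\<close>
  are inherited by averages. The linear map \<open>L\<close>, which may have a kernel, lets the Lipschitz bound
  refer to the norm of another space.
\<close>

lemma Lipschitz_linearization_euclidean:
  fixes h :: "'n::euclidean_space \<Rightarrow> 'w::banach" and L :: "'n \<Rightarrow> 'v::real_normed_vector"
  assumes "R > 0" and L: "linear L"
    and lip: "\<And>x y. norm x \<le> R \<Longrightarrow> norm y \<le> R \<Longrightarrow> norm (h x - h y) \<le> norm (L (x - y))"
  obtains T where "linear T" "\<And>v. norm (T v) \<le> norm (L v)"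
    "\<forall>(\<eta> :: 'w \<Rightarrow> real) A d. bounded_linear \<eta> \<longrightarrow> linear A \<longrightarrow>
        (\<forall>u. norm u \<le> R \<longrightarrow> \<eta> (h u) = A u + d) \<longrightarrow> (\<forall>v. \<eta> (T v) = A v)"
proof -
  \<comment> \<open>The bump function has radius \<open>k\<close> and lives on the cube \<open>Q\<close>; shifts shorter than \<open>k\<close> move \<open>Q\<close>
      inside the cube \<open>B\<close>, and \<open>k\<close> is so small that \<open>B\<close> lies in the ball of radius \<open>R\<close>.\<close>
  define k where "k = R / (2 * DIM('n))"
  have "k > 0" using \<open>R > 0\<close> by (simp add: k_def)
  define Q :: "'n set" where "Q = cbox (- (k *\<^sub>R One)) (k *\<^sub>R One)"
  define B :: "'n set" where "B = cbox (- ((2 * k) *\<^sub>R One)) ((2 * k) *\<^sub>R One)"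
  have Q_iff: "w \<in> Q \<longleftrightarrow> (\<forall>i\<in>Basis. \<bar>w \<bullet> i\<bar> \<le> k)" for w
    by (auto simp: Q_def mem_box abs_le_iff)
  have B_iff: "w \<in> B \<longleftrightarrow> (\<forall>i\<in>Basis. \<bar>w \<bullet> i\<bar> \<le> 2 * k)" for w
    by (auto simp: B_def mem_box abs_le_iff)
  have B_R: "norm w \<le> R" if "w \<in> B" for w
  proof -
    have "norm w \<le> (\<Sum>i\<in>Basis. \<bar>w \<bullet> i\<bar>)" by (rule norm_le_l1)
    also have "\<dots> \<le> (\<Sum>i\<in>(Basis::'n set). 2 * k)"
      using that by (intro sum_mono) (auto simp: B_iff)
    finally show ?thesis by (simp add: k_def)
  qed
  have Q_ball: "w \<notin> ball 0 k" if "w \<notin> Q" for w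
    using that Basis_le_norm[of _ w] by (fastforce simp: Q_iff)
  have Q_shift: "w + c \<in> B" if "w \<in> Q" "norm c < k" for w c
    unfolding B_iff
  proof
    fix i :: 'n assume "i \<in> Basis"
    then show "\<bar>(w + c) \<bullet> i\<bar> \<le> 2 * k"
      using that Basis_le_norm[of i c] by (fastforce simp: Q_iff inner_add_left)
  qed
  have QB: "Q \<subseteq> B" using Q_shift[of _ 0] \<open>k > 0\<close> by auto
  have blL: "bounded_linear L" using L by (simp add: linear_conv_bounded_linear)
  have h_cont: "continuous_on B h"
  proof (rule continuous_on_iff[THEN iffD2], intro ballI allI impI)
    fix x and e :: real assume "x \<in> B" "e > 0"
    obtain K where K: "K > 0" "\<And>x. norm (L x) \<le> norm x * K"
      using bounded_linear.pos_bounded[OF blL] by blast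
    have "dist (h y) (h x) < e" if "y \<in> B" "dist y x < e / K" for y
    proof -
      have "dist (h y) (h x) \<le> norm (L (y - x))"
        using lip B_R that \<open>x \<in> B\<close> by (simp add: dist_norm)
      also have "\<dots> \<le> dist y x * K" using K(2) by (simp add: dist_norm)
      also have "\<dots> < e" using that K(1) by (simp add: field_simps)
      finally show ?thesis .
    qed
    then show "\<exists>d>0. \<forall>y\<in>B. dist y x < d \<longrightarrow> dist (h y) (h x) < e"
      using K(1) \<open>e > 0\<close> by (intro exI[of _ "e / K"]) auto
  qed
  have bump_cont: "continuous_on S (\<lambda>u. bump k (u - c))" for S and c :: 'n
    by (rule continuous_on_compose2[OF continuous_on_bump]) (auto intro!: continuous_intros)

  define g where "g c = integral B (\<lambda>u. bump k (u - c) *\<^sub>R h u)" for c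
  define D where "D c u = blinfun_scaleR_left (h u) o\<^sub>L (- bump_deriv k (u - c))" for c u
  have "(g has_derivative integral B (D 0)) (at 0 within UNIV)"
    unfolding g_def B_def
  proof (rule leibniz_rule)
    fix c u :: 'n
    have 1: "((\<lambda>c. u - c) has_derivative (\<lambda>v. - v)) (at c)"
      by (auto intro!: derivative_eq_intros)
    have "((\<lambda>c. bump k (u - c)) has_derivative (\<lambda>v. bump_deriv k (u - c) (- v))) (at c)"
      by (rule has_derivative_compose[OF 1 bump_has_derivative])
    then show "((\<lambda>c. bump k (u - c) *\<^sub>R h u) has_derivative blinfun_apply (D c u)) (at c within UNIV)"
      by (rule has_derivative_eq_rhs[OF has_derivative_scaleR_left])
        (simp add: D_def fun_eq_iff blinfun.bilinear_simps)
  next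
    fix c :: 'n
    show "(\<lambda>u. bump k (u - c) *\<^sub>R h u) integrable_on cbox (- ((2 * k) *\<^sub>R One)) ((2 * k) *\<^sub>R One)"
      using h_cont bump_cont by (intro integrable_continuous continuous_intros) (auto simp: B_def)
  next
    have "continuous_on (UNIV \<times> B) (\<lambda>x. h (snd x))"
      by (rule continuous_on_compose2[OF h_cont]) (auto intro!: continuous_intros)
    moreover have "continuous_on (UNIV \<times> B) (\<lambda>x. bump_deriv k (snd x - fst x))"
      by (rule continuous_on_compose2[OF continuous_on_bump_deriv[of UNIV]]) (auto intro!: continuous_intros)
    ultimately show "continuous_on (UNIV \<times> cbox (- ((2 * k) *\<^sub>R One)) ((2 * k) *\<^sub>R One)) (\<lambda>(c, u). D c u)"
      unfolding D_def split_beta B_def by (intro continuous_intros)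
  qed auto
  then obtain G where G: "(g has_derivative blinfun_apply G) (at 0)"
    by auto

  have shifted: "((\<lambda>w. bump k w *\<^sub>R h (w + c)) has_integral g c) Q" if "norm c < k" for c
  proof -
    let ?F = "\<lambda>u. bump k (u - c) *\<^sub>R h u" and ?a = "(2 * k) *\<^sub>R One :: 'n"
    let ?G = "\<lambda>w. bump k w *\<^sub>R h (w + c)"
    have "?F integrable_on B"
      using h_cont bump_cont unfolding B_def by (intro integrable_continuous continuous_intros)
    then have "(?F has_integral g c) (cbox ((- ?a - c) + c) ((?a - c) + c))"
      unfolding g_def by (simp add: B_def integrable_integral)
    then have F: "(?G has_integral g c) (cbox (- ?a - c) (?a - c))"
      unfolding has_integral_shift_cbox_iff[symmetric] by (simp add: o_def add.commute)
    \<comment> \<open>The domain after the substitution depends on \<open>c\<close>; since the bump function vanishes outside \<open>Q\<close>,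
        it can be replaced by \<open>Q\<close> for all \<open>c\<close>.\<close>
    have "?G integrable_on Q"
      unfolding Q_def
      by (intro integrable_continuous continuous_intros continuous_on_bump continuous_on_compose2[OF h_cont])
        (use Q_shift \<open>norm c < k\<close> in \<open>auto simp: Q_def\<close>)
    then obtain j where j: "(?G has_integral j) Q" by blast
    have "Q \<subseteq> cbox (- ?a - c) (?a - c)"
      using Q_shift[OF _ that] by (fastforce simp: B_def mem_box algebra_simps)
    then have "(?G has_integral j) (cbox (- ?a - c) (?a - c))"
      using j bump_eq_0[OF \<open>k > 0\<close>] Q_ball by (intro has_integral_on_superset[OF j]) auto
    with F j show ?thesis using has_integral_unique by blast
  qed

  define C where "C = integral Q (bump k)"
  have bump_C: "(bump k has_integral C) Q"
    unfolding C_def Q_def by (intro integrable_integral integrable_continuous continuous_on_bump)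
  have "C > 0"
    unfolding C_def Q_def using \<open>k > 0\<close>
    by (intro integral_pos_continuous[where x = 0] continuous_on_bump bump_nonneg)
      (auto simp: mem_box bump_def)

  have bound: "norm (g c - g 0) \<le> C * norm (L c)" if "norm c < k" for c
  proof -
    have I: "((\<lambda>w. bump k w *\<^sub>R h (w + c) - bump k w *\<^sub>R h (w + 0)) has_integral (g c - g 0)) Q"
      by (intro has_integral_diff shifted) (use that \<open>k > 0\<close> in auto)
    have J: "((\<lambda>w. bump k w * norm (L c)) has_integral (C * norm (L c))) Q"
      by (intro has_integral_mult_left bump_C)
    have "norm (integral Q (\<lambda>w. bump k w *\<^sub>R h (w + c) - bump k w *\<^sub>R h (w + 0)))
        \<le> integral Q (\<lambda>w. bump k w * norm (L c))"
    proof (rule integral_norm_bound_integral)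
      fix w assume "w \<in> Q"
      then have "norm (h (w + c) - h w) \<le> norm (L c)"
        using lip[of "w + c" w] B_R Q_shift[OF _ that] QB by auto
      then show "norm (bump k w *\<^sub>R h (w + c) - bump k w *\<^sub>R h (w + 0)) \<le> bump k w * norm (L c)"
        using bump_nonneg[of k w] by (simp add: mult_left_mono flip: scaleR_diff_right)
    qed (use I J in blast)+
    then show ?thesis by (simp only: integral_unique[OF I] integral_unique[OF J])
  qed
  have G_bound: "norm (G v) \<le> C * norm (L v)" for v
  proof (rule has_derivative_at_0_norm_bound[OF G])
    show "k / (norm v + 1) > 0" using \<open>k > 0\<close> by (simp add: add_nonneg_pos)
    fix t assume t: "0 < t" "t < k / (norm v + 1)"
    have "t * norm v \<le> t * (norm v + 1)" using t by simp
    also have "\<dots> < k" using t(2) by (subst (asm) pos_less_divide_eq) (auto intro: add_nonneg_pos)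
    finally show "norm (g (t *\<^sub>R v) - g 0) \<le> t * (C * norm (L v))"
      using bound[of "t *\<^sub>R v"] t by (simp add: linear_cmul[OF L] mult.left_commute)
  qed
  have G_functional: "\<eta> (G v) = C * A v"
    if \<eta>: "bounded_linear (\<eta> :: 'w \<Rightarrow> real)" and A: "linear A"
      and eq: "\<And>u. norm u \<le> R \<Longrightarrow> \<eta> (h u) = A u + d" for \<eta> A d v
  proof -
    interpret \<eta>: bounded_linear \<eta> by (rule \<eta>)
    have g_eq: "\<eta> (g c) = \<eta> (g 0) + C * A c" if "norm c < k" for c
    proof -
      have "((\<lambda>w. \<eta> (bump k w *\<^sub>R h (w + c)) - \<eta> (bump k w *\<^sub>R h (w + 0)))
          has_integral (\<eta> (g c) - \<eta> (g 0))) Q"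
        by (intro has_integral_diff has_integral_linear[OF shifted \<eta>, unfolded o_def])
          (use that \<open>k > 0\<close> in auto)
      moreover have "\<eta> (bump k w *\<^sub>R h (w + c)) - \<eta> (bump k w *\<^sub>R h (w + 0)) = bump k w * A c"
        if "w \<in> Q" for w
      proof -
        have "norm (w + c) \<le> R" "norm w \<le> R"
          using B_R Q_shift[OF that \<open>norm c < k\<close>] QB that by auto
        then show ?thesis
          using eq[of "w + c"] eq[of w] by (simp add: \<eta>.scaleR linear_add[OF A] algebra_simps)
      qed
      ultimately have "((\<lambda>w. bump k w * A c) has_integral (\<eta> (g c) - \<eta> (g 0))) Q"
        by (simp cong: has_integral_cong)
      moreover have "((\<lambda>w. bump k w * A c) has_integral C * A c) Q"
        by (intro has_integral_mult_left bump_C)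
      ultimately have "\<eta> (g c) - \<eta> (g 0) = C * A c" by (rule has_integral_unique)
      then show ?thesis by simp
    qed
    have d1: "((\<lambda>c. \<eta> (g c)) has_derivative (\<lambda>v. \<eta> (G v))) (at 0)"
      by (rule \<eta>.has_derivative[OF G])
    have d2: "((\<lambda>c. \<eta> (g c)) has_derivative (\<lambda>v. C * A v)) (at 0)"
    proof (rule has_derivative_transform_within_open)
      have "bounded_linear A" using A by (simp add: linear_conv_bounded_linear)
      then show "((\<lambda>c. \<eta> (g 0) + C * A c) has_derivative (\<lambda>v. C * A v)) (at 0)"
        by (auto intro!: derivative_eq_intros bounded_linear_imp_has_derivative)
      show "0 \<in> ball (0::'n) k" using \<open>k > 0\<close> by simp
    qed (use g_eq in auto)
    show ?thesis by (rule fun_cong[OF has_derivative_unique[OF d1 d2]])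
  qed
  show thesis
  proof (rule that[of "\<lambda>v. G v /\<^sub>R C"])
    show "linear (\<lambda>v. G v /\<^sub>R C)"
      by (intro linear_compose_scale_right bounded_linear.linear blinfun.bounded_linear_right)
    show "norm (G v /\<^sub>R C) \<le> norm (L v)" for v
      using G_bound[of v] \<open>C > 0\<close> by (simp add: field_simps)
    show "\<forall>(\<eta> :: 'w \<Rightarrow> real) A d. bounded_linear \<eta> \<longrightarrow> linear A \<longrightarrow>
        (\<forall>u. norm u \<le> R \<longrightarrow> \<eta> (h u) = A u + d) \<longrightarrow> (\<forall>v. \<eta> (G v /\<^sub>R C) = A v)"
    proof (intro allI impI)
      fix \<eta> :: "'w \<Rightarrow> real" and A d v
      assume "bounded_linear \<eta>" "linear A" "\<forall>u. norm u \<le> R \<longrightarrow> \<eta> (h u) = A u + d"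
      then show "\<eta> (G v /\<^sub>R C) = A v"
        using G_functional[of \<eta> A d v] \<open>C > 0\<close> by (simp add: linear_cmul[OF bounded_linear.linear])
    qed
  qed
qed

section \<open>Parametrizing a finite-dimensional space\<close>

text \<open>
  A finite index type attached to every real vector space: the elements of a finite spanning set if
  there is one. It turns the dimension of the space, which is only known through a hypothesis, into
  a type, so that integration over a Euclidean space becomes available. The vector \<open>0\<close> is added
  because a type must not be empty.
\<close>

definition spanning_set :: "'a::real_vector set" where
  "spanning_set = (if finite_dimensional TYPE('a)
     then insert 0 (SOME B. finite B \<and> span B = (UNIV :: 'a set)) else {0})"

lemma finite_spanning_set: "finite (spanning_set :: 'a::real_vector set)"
  and span_spanning_set: "finite_dimensional TYPE('a) \<Longrightarrow> span (spanning_set :: 'a set) = UNIV"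
proof -
  define B :: "'a set" where "B = (SOME B. finite B \<and> span B = UNIV)"
  have B: "finite B \<and> span B = UNIV" if "finite_dimensional TYPE('a)"
    using that unfolding finite_dimensional_def B_def by (rule someI_ex)
  show "finite (spanning_set :: 'a set)"
    using B by (simp add: spanning_set_def flip: B_def)
  show "span (spanning_set :: 'a set) = UNIV" if "finite_dimensional TYPE('a)"
    using B[OF that] that by (simp add: spanning_set_def span_insert_0 flip: B_def)
qed

typedef (overloaded) 'a spanning_index = "spanning_set :: 'a::real_vector set"
  by (rule exI[of _ 0]) (simp add: spanning_set_def)

instance spanning_index :: (real_vector) finite
proof
  show "finite (UNIV :: 'a spanning_index set)"
    by (simp add: type_definition.univ[OF type_definition_spanning_index] finite_spanning_set)
qed

text \<open>The coordinates are redundant in general, as a spanning set need not be independent.\<close>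

lemma euclidean_parametrization:
  assumes "finite_dimensional TYPE('v::real_vector)"
  obtains L :: "real ^ ('v::real_vector) spanning_index \<Rightarrow> 'v" where "linear L" "surj L"
proof
  let ?L = "\<lambda>c :: real ^ 'v spanning_index. \<Sum>i\<in>UNIV. c $ i *\<^sub>R Rep_spanning_index i"
  show "linear ?L"
    by (rule linearI) (simp_all add: scaleR_add_left sum.distrib scaleR_sum_right)
  show "surj ?L"
  proof (rule surjI)
    fix x :: 'v
    have bij: "bij_betw Rep_spanning_index (UNIV :: 'v spanning_index set) spanning_set"
      using type_definition.Rep_range[OF type_definition_spanning_index]
      by (simp add: bij_betw_def inj_on_def Rep_spanning_index_inject)
    have "x \<in> span spanning_set" using span_spanning_set[OF assms] by simp
    then obtain u where "x = (\<Sum>v\<in>spanning_set. u v *\<^sub>R v)"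
      by (auto simp: span_finite[OF finite_spanning_set])
    then have "\<exists>c. ?L c = x"
      by (intro exI[of _ "\<chi> i. u (Rep_spanning_index i)"])
        (simp add: sum.reindex_bij_betw[OF bij, where g = "\<lambda>v. u v *\<^sub>R v"])
    then show "?L (SOME c. ?L c = x) = x" by (rule someI_ex)
  qed
qed

lemma separable_space_finite_dimensional:
  assumes "finite_dimensional TYPE('v::real_normed_vector)"
  shows "separable_space (euclidean :: 'v topology)"
proof -
  obtain L :: "real ^ 'v spanning_index \<Rightarrow> 'v" where L: "linear L" "surj L"
    using euclidean_parametrization[OF assms] .
  have "continuous_on UNIV L"
    using L(1) by (intro linear_continuous_on) (simp add: linear_conv_bounded_linear)
  moreover have "separable_space (euclidean :: (real ^ 'v spanning_index) topology)"
  proof -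
    obtain D :: "(real ^ 'v spanning_index) set" where "countable D" "UNIV \<subseteq> closure D"
      by (rule separable[of UNIV])
    then have "euclidean closure_of D = topspace euclidean" by auto
    then show ?thesis
      using \<open>countable D\<close> unfolding separable_space_def by (intro exI[of _ D]) simp
  qed
  ultimately show ?thesis
    using separable_space_continuous_map_image[of euclidean euclidean L] L(2) by simp
qed

text \<open>
  The Euclidean case applies to \<open>f \<circ> L\<close> for a linear surjection \<open>L\<close>. The bound
  \<open>norm (T c) \<le> norm (L c)\<close> survives composition with a linear right inverse of \<open>L\<close>.
\<close>

lemma Lipschitz_linearization:
  fixes f :: "'v::real_normed_vector \<Rightarrow> 'w::banach"
  assumes fin: "finite_dimensional TYPE('v)" and "r > 0"
    and lip: "\<And>x y. norm x \<le> r \<Longrightarrow> norm y \<le> r \<Longrightarrow> norm (f x - f y) \<le> norm (x - y)"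
  obtains T where "linear T" "\<And>x. norm (T x) \<le> norm x"
    "\<forall>(\<eta> :: 'w \<Rightarrow> real) A d. bounded_linear \<eta> \<longrightarrow> linear A \<longrightarrow>
        (\<forall>u. norm u \<le> r \<longrightarrow> \<eta> (f u) = A u + d) \<longrightarrow> (\<forall>x. \<eta> (T x) = A x)"
proof -
  obtain L :: "real ^ 'v spanning_index \<Rightarrow> 'v" where L: "linear L" "surj L"
    using euclidean_parametrization[OF fin] .
  obtain M where M: "linear M" "L \<circ> M = id"
    using linear_surjective_right_inverse[OF L] by blast
  have "bounded_linear L" using L(1) by (simp add: linear_conv_bounded_linear)
  then obtain K where "K > 0" and K: "\<And>c. norm (L c) \<le> norm c * K"
    using bounded_linear.pos_bounded by blast
  have small: "norm (L c) \<le> r" if "norm c \<le> r / K" for c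
    using K[of c] that \<open>K > 0\<close> by (simp add: field_simps)
  have lip': "norm ((f \<circ> L) x - (f \<circ> L) y) \<le> norm (L (x - y))" if "norm x \<le> r / K" "norm y \<le> r / K" for x y
    using lip[OF small[OF that(1)] small[OF that(2)]] by (simp add: linear_diff[OF L(1)])
  have "r / K > 0" using \<open>r > 0\<close> \<open>K > 0\<close> by simp
  obtain T where T: "linear T" "\<And>c. norm (T c) \<le> norm (L c)"
    "\<forall>(\<eta> :: 'w \<Rightarrow> real) A d. bounded_linear \<eta> \<longrightarrow> linear A \<longrightarrow>
        (\<forall>u. norm u \<le> r / K \<longrightarrow> \<eta> ((f \<circ> L) u) = A u + d) \<longrightarrow> (\<forall>c. \<eta> (T c) = A c)"
    by (rule Lipschitz_linearization_euclidean[OF \<open>r / K > 0\<close> L(1) lip'], assumption, assumption, rule that)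
  have LM: "L (M x) = x" for x using M(2) by (metis comp_apply id_apply)
  show thesis
  proof (rule that[of "T \<circ> M"])
    show "linear (T \<circ> M)" by (rule linear_compose[OF M(1) T(1)])
    show "norm ((T \<circ> M) x) \<le> norm x" for x using T(2)[of "M x"] by (simp add: LM)
    show "\<forall>(\<eta> :: 'w \<Rightarrow> real) A d. bounded_linear \<eta> \<longrightarrow> linear A \<longrightarrow>
        (\<forall>u. norm u \<le> r \<longrightarrow> \<eta> (f u) = A u + d) \<longrightarrow> (\<forall>x. \<eta> ((T \<circ> M) x) = A x)"
    proof (intro allI impI)
      fix \<eta> :: "'w \<Rightarrow> real" and A d x
      assume "bounded_linear \<eta>" "linear A" and eq: "\<forall>u. norm u \<le> r \<longrightarrow> \<eta> (f u) = A u + d"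
      then have "\<eta> (T (M x)) = (A \<circ> L) (M x)"
        using T(3)[rule_format, of \<eta> "A \<circ> L" d] linear_compose[OF L(1), of A] small by simp
      then show "\<eta> ((T \<circ> M) x) = A x" by (simp add: LM)
    qed
  qed
qed

section \<open>Isometries of a polyhedral ball\<close>

text \<open>
  The points \<open>p\<close> and \<open>-p\<close> have distance \<open>2\<close>, and so do their images. The increments of \<open>\<eta>\<close> from
  \<open>f (- p)\<close> to \<open>f u\<close> and from \<open>f u\<close> to \<open>f p\<close> are at most \<open>1 + \<phi> u\<close> and \<open>1 - \<phi> u\<close> and add up to
  \<open>2\<close>, so both bounds are equalities.
\<close>

lemma facet_functional_factors:
  fixes f :: "'v::real_normed_vector \<Rightarrow> 'w::real_normed_vector" and F :: "('v \<Rightarrow>\<^sub>L real) set"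
  assumes iso: "\<And>x y. norm x \<le> 1 \<Longrightarrow> norm y \<le> 1 \<Longrightarrow> norm (f x - f y) = norm (x - y)"
    and F: "finite F" "\<And>\<psi>. \<psi> \<in> F \<Longrightarrow> norm \<psi> = 1"
      "cball 0 1 = (\<Inter>\<psi>\<in>F. {x. \<bar>blinfun_apply \<psi> x\<bar> \<le> 1})"
    and p: "\<phi> \<in> F" "blinfun_apply \<phi> p = 1" "\<And>\<psi>. \<psi> \<in> F - {\<phi>} \<Longrightarrow> \<bar>blinfun_apply \<psi> p\<bar> < 1"
  shows "\<exists>\<eta> d. bounded_linear (\<eta> :: 'w \<Rightarrow> real) \<and> (\<forall>y. \<bar>\<eta> y\<bar> \<le> norm y) \<and>
    (\<forall>\<^sub>F u in nhds 0. \<eta> (f u) = blinfun_apply \<phi> u + d)"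
proof -
  have "\<bar>blinfun_apply \<psi> p\<bar> \<le> 1" if "\<psi> \<in> F" for \<psi>
    using p(2) p(3)[of \<psi>] that by (cases "\<psi> = \<phi>") auto
  then have "p \<in> cball 0 1" unfolding F(3) by blast
  then have "norm p \<le> 1" by simp
  moreover have "1 \<le> norm p" using norm_blinfun[of \<phi> p] F(2)[OF p(1)] p(2) by simp
  ultimately have "norm p = 1" by simp
  obtain \<eta> :: "'w \<Rightarrow> real" where \<eta>: "bounded_linear \<eta>" "\<And>y. \<bar>\<eta> y\<bar> \<le> norm y"
    and \<eta>p: "\<eta> (f p - f (- p)) = norm (f p - f (- p))"
    by (rule norming_functional[of "f p - f (- p)"]) (rule that)
  interpret \<eta>: bounded_linear \<eta> by (rule \<eta>(1))
  have "norm (f p - f (- p)) = 2"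
    using iso[of p "- p"] \<open>norm p = 1\<close> by (simp flip: scaleR_2)
  then have two: "\<eta> (f p) - \<eta> (f (- p)) = 2" using \<eta>p by (simp add: \<eta>.diff)
  have "\<forall>\<^sub>F u in nhds 0. u \<in> ball (0::'v) 1"
    by (rule eventually_nhds_in_open) auto
  moreover have "\<forall>\<^sub>F u in nhds 0. norm (p - u) \<le> 1 - \<phi> u \<and> norm (p + u) \<le> 1 + \<phi> u"
    using p(2,3) by (rule facet_distance[OF F(1,3)])
  ultimately have "\<forall>\<^sub>F u in nhds 0. \<eta> (f u) = \<phi> u + (\<eta> (f p) - 1)"
  proof eventually_elim
    case (elim u)
    then have "norm u \<le> 1" by simp
    have "\<eta> (f p) - \<eta> (f u) \<le> 1 - \<phi> u"
      using \<eta>(2)[of "f p - f u"] iso[of p u] conjunct1[OF elim(2)] \<open>norm u \<le> 1\<close> \<open>norm p = 1\<close> by (simp add: \<eta>.diff)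
    moreover have "\<eta> (f u) - \<eta> (f (- p)) \<le> 1 + \<phi> u"
      using \<eta>(2)[of "f u - f (- p)"] iso[of u "- p"] conjunct2[OF elim(2)] \<open>norm u \<le> 1\<close> \<open>norm p = 1\<close>
      by (simp add: \<eta>.diff add.commute)
    ultimately show ?case using two by simp
  qed
  with \<eta> show ?thesis by blast
qed

theorem theorem4p1:
  assumes "polyhedral_space TYPE('a::banach)"
  shows "isometrically_representing (cball (0::'a) 1) TYPE('b::banach)"
proof -
  have fin: "finite_dimensional TYPE('a)" using assms by (simp add: polyhedral_space_def)
  obtain F0 :: "('a \<Rightarrow>\<^sub>L real) set" where F0: "finite F0" "\<And>\<phi>. \<phi> \<in> F0 \<Longrightarrow> norm \<phi> = 1"
    "cball 0 1 = (\<Inter>\<phi>\<in>F0. {x. \<bar>blinfun_apply \<phi> x\<bar> \<le> 1})"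
    using assms by (auto simp: polyhedral_space_def)
  obtain F :: "('a \<Rightarrow>\<^sub>L real) set" where F: "finite F" "\<And>\<phi>. \<phi> \<in> F \<Longrightarrow> norm \<phi> = 1"
    "cball 0 1 = (\<Inter>\<phi>\<in>F. {x. \<bar>blinfun_apply \<phi> x\<bar> \<le> 1})"
    and facet: "\<And>\<phi>. \<phi> \<in> F \<Longrightarrow> \<exists>p. \<phi> p = 1 \<and> (\<forall>\<psi>\<in>F - {\<phi>}. \<bar>\<psi> p\<bar> < 1)"
    using minimal_polyhedral_family[OF F0] by blast
  have "embeds_linearly_isometrically TYPE('a) TYPE('b)"
    if emb: "embeds_isometrically (cball (0::'a) 1) TYPE('b)"
  proof -
    obtain f :: "'a \<Rightarrow> 'b" where f: "\<forall>x\<in>cball 0 1. \<forall>y\<in>cball 0 1. dist (f x) (f y) = dist x y"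
      using emb unfolding embeds_isometrically_def by blast
    have iso: "norm (f x - f y) = norm (x - y)" if "norm x \<le> 1" "norm y \<le> 1" for x y
      using f that by (simp add: dist_norm)
    have "\<exists>\<eta> d. bounded_linear (\<eta> :: 'b \<Rightarrow> real) \<and> (\<forall>y. \<bar>\<eta> y\<bar> \<le> norm y) \<and>
        (\<forall>\<^sub>F u in nhds 0. \<eta> (f u) = blinfun_apply \<phi> u + d)" if \<phi>: "\<phi> \<in> F" for \<phi>
    proof -
      obtain p where p: "\<phi> p = 1" "\<And>\<psi>. \<psi> \<in> F - {\<phi>} \<Longrightarrow> \<bar>\<psi> p\<bar> < 1"
        using facet[OF \<phi>] by blast
      show ?thesis by (rule facet_functional_factors[OF iso F \<phi> p])
    qed
    then obtain \<eta> :: "('a \<Rightarrow>\<^sub>L real) \<Rightarrow> 'b \<Rightarrow> real" and d where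
      \<eta>: "\<And>\<phi>. \<phi> \<in> F \<Longrightarrow> bounded_linear (\<eta> \<phi>)" "\<And>\<phi> y. \<phi> \<in> F \<Longrightarrow> \<bar>\<eta> \<phi> y\<bar> \<le> norm y"
      and near: "\<And>\<phi>. \<phi> \<in> F \<Longrightarrow> \<forall>\<^sub>F u in nhds 0. \<eta> \<phi> (f u) = blinfun_apply \<phi> u + d \<phi>"
      by metis
    have "\<forall>\<^sub>F u in nhds 0. \<forall>\<phi>\<in>F. \<eta> \<phi> (f u) = blinfun_apply \<phi> u + d \<phi>"
      using F(1) near by (simp add: eventually_ball_finite)
    then obtain \<delta> where "\<delta> > 0"
      and \<delta>: "\<And>u \<phi>. norm u < \<delta> \<Longrightarrow> \<phi> \<in> F \<Longrightarrow> \<eta> \<phi> (f u) = blinfun_apply \<phi> u + d \<phi>"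
      unfolding eventually_nhds_metric by auto
    define r where "r = min 1 (\<delta> / 2)"
    have r: "r > 0" "r \<le> 1" "r < \<delta>" using \<open>\<delta> > 0\<close> by (auto simp: r_def)
    have lip: "norm (f x - f y) \<le> norm (x - y)" if "norm x \<le> r" "norm y \<le> r" for x y
      using iso[of x y] that r(2) by simp
    obtain T where T: "linear T" "\<And>x. norm (T x) \<le> norm x"
      and T_functional: "\<forall>(\<eta> :: 'b \<Rightarrow> real) A d. bounded_linear \<eta> \<longrightarrow> linear A \<longrightarrow>
        (\<forall>u. norm u \<le> r \<longrightarrow> \<eta> (f u) = A u + d) \<longrightarrow> (\<forall>x. \<eta> (T x) = A x)"
      by (rule Lipschitz_linearization[OF fin r(1) lip], assumption, assumption, rule that)
    have "\<bar>blinfun_apply \<phi> x\<bar> \<le> norm (T x)" if "\<phi> \<in> F" for \<phi> x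
    proof -
      have "linear (blinfun_apply \<phi>)"
        by (rule bounded_linear.linear[OF blinfun.bounded_linear_right])
      moreover have "\<forall>u. norm u \<le> r \<longrightarrow> \<eta> \<phi> (f u) = blinfun_apply \<phi> u + d \<phi>"
        using \<delta>[OF _ that] r(3) by simp
      ultimately have "\<eta> \<phi> (T x) = blinfun_apply \<phi> x"
        using T_functional \<eta>(1)[OF that] by blast
      then show ?thesis using \<eta>(2)[OF that, of "T x"] by simp
    qed
    then have "norm x \<le> norm (T x)" for x
      by (intro norm_le_polyhedral[OF F(3)]) auto
    then show ?thesis
      unfolding embeds_linearly_isometrically_def using T by (meson antisym)
  qed
  then show ?thesis
    unfolding isometrically_representing_def using separable_space_finite_dimensional[OF fin] by blast
qed

end
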